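(* Let $\varphi:[0,1]\to\mathbb{R}$ be a continuous function that maps sets of Lebesgue measure zero to sets of Lebesgue measure zero. Suppose also that $\varphi(0)=0$. Then $E(\mathbb{Z},\varphi)=\{e^{2\pi i k\varphi(x)}:k\in\mathbb{Z}\}$ is an orthonormal basis for $L^2[0,1]$ if and only if either $\varphi(x)=x$ for all $x\in[0,1]$ or $\varphi(x)=-x$ for all $x\in[0,1]$.
   Context: $L^2[0,1]$ is taken with respect to Lebesgue measure; the collection $E(\mathbb{Z},\varphi)$ is indexed by $\mathbb{Z}$. *)

theory Defs
  imports "HOL-Analysis.Analysis"
begin

text \<open>
  Elements of \<open>L\<^sup>2(M)\<close> are represented by square-integrable functions rather than by
  their almost-everywhere classes.  The inner product and the norm below do not distinguish
  functions that agree almost everywhere, so the notion of orthonormal basis is unaffected.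
\<close>

definition L2_space :: "'a measure \<Rightarrow> ('a \<Rightarrow> complex) set" where
  "L2_space M = {f \<in> borel_measurable M. integrable M (\<lambda>x. (cmod (f x))\<^sup>2)}"

definition L2_inner :: "'a measure \<Rightarrow> ('a \<Rightarrow> complex) \<Rightarrow> ('a \<Rightarrow> complex) \<Rightarrow> complex" where
  "L2_inner M f g = (LINT x|M. f x * cnj (g x))"

definition L2_norm :: "'a measure \<Rightarrow> ('a \<Rightarrow> complex) \<Rightarrow> real" where
  "L2_norm M f = sqrt (LINT x|M. (cmod (f x))\<^sup>2)"

definition L2_orthonormal :: "'a measure \<Rightarrow> ('i \<Rightarrow> 'a \<Rightarrow> complex) \<Rightarrow> bool" where
  "L2_orthonormal M e \<longleftrightarrow>
     (\<forall>i. e i \<in> L2_space M) \<and>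
     (\<forall>i j. L2_inner M (e i) (e j) = (if i = j then 1 else 0))"

text \<open>Density of the linear span: finite linear combinations approximate every element.\<close>

definition L2_total :: "'a measure \<Rightarrow> ('i \<Rightarrow> 'a \<Rightarrow> complex) \<Rightarrow> bool" where
  "L2_total M e \<longleftrightarrow>
     (\<forall>f \<in> L2_space M. \<forall>\<epsilon> > 0. \<exists>S c. finite S \<and>
        L2_norm M (\<lambda>x. f x - (\<Sum>i\<in>S. c i * e i x)) < \<epsilon>)"

definition L2_orthonormal_basis :: "'a measure \<Rightarrow> ('i \<Rightarrow> 'a \<Rightarrow> complex) \<Rightarrow> bool" where
  "L2_orthonormal_basis M e \<longleftrightarrow> L2_orthonormal M e \<and> L2_total M e"

text \<open>The family \<open>E(\<int>, \<phi>)\<close>, indexed by the integer frequency.\<close>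

definition exp_family :: "(real \<Rightarrow> real) \<Rightarrow> int \<Rightarrow> real \<Rightarrow> complex" where
  "exp_family \<phi> k x = exp (2 * of_real pi * \<i> * of_int k * of_real (\<phi> x))"

end

theory Submission
  imports Defs
begin

text \<open>
  Write \<open>e(t) = exp(2 \<pi> i t)\<close>, so that the family consists of the functions
  \<open>e(k \<phi>(x))\<close>.  Each half of the notion of orthonormal basis says something about the map
  \<open>x \<mapsto> e(\<phi>(x))\<close> from the unit interval to the circle.

  \<^item> Orthogonality to the constant function says that the image of Lebesgue measure under this
    map has the Fourier coefficients of the arc length measure.  By the Stone--Weierstrass theorem
    the two measures agree on open sets, so that the preimage of an arc has the length of the arc
    (\<open>arc_length_le\<close>; an inequality is enough below).

  \<^item> Totality says that the coordinate function \<open>x\<close> is an \<open>L\<^sup>2\<close>-limit, hence along a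
    subsequence an almost everywhere limit, of functions that depend on \<open>e(\<phi>(x))\<close> only.
    So \<open>\<phi>\<close> modulo 1 is injective off a null set \<open>B\<close> (\<open>L2_total_separates\<close>).

  Since \<open>\<phi> ` B\<close> is null as well, every nondegenerate interval of values of \<open>\<phi>\<close>
  contains a value that is taken off \<open>B\<close> only.  If \<open>\<phi>\<close> were not injective, the
  intermediate value theorem would produce such a value that is taken twice; so \<open>\<phi>\<close> is
  strictly monotone (\<open>inj_on_of_inj_off_null\<close>).  Suppose that it is increasing; the other case
  follows by passing to \<open>- \<phi>\<close>, which only permutes the family.  If \<open>\<phi> 1 > 1\<close>, some
  value and its translate by 1 would both be taken off \<open>B\<close> only, against injectivity modulo 1;
  if \<open>\<phi> 1 < 1\<close>, an arc of positive length would have an empty preimage.  So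
  \<open>\<phi>\<close> is an increasing bijection of the unit interval, the preimages of the arcs
  \<open>(0, \<phi> s)\<close> and \<open>(\<phi> s, 1)\<close> are \<open>(0, s)\<close> and \<open>(s, 1)\<close>, and comparing
  lengths gives \<open>\<phi> s \<le> s\<close> and \<open>1 - \<phi> s \<le> 1 - s\<close> (\<open>basis_imp_identity\<close>).

  Conversely, the classical characters \<open>e(k x)\<close> are an orthonormal basis: square-integrable
  functions are approximated by bounded ones, these by continuous functions that vanish at both end
  points, and these uniformly by trigonometric polynomials (\<open>torus_char_total\<close>).
\<close>

section \<open>Characters and trigonometric polynomials\<close>

abbreviation torus_char :: "int \<Rightarrow> real \<Rightarrow> complex" where
  "torus_char \<equiv> exp_family (\<lambda>x. x)"

abbreviation circle_map :: "real \<Rightarrow> complex" where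
  "circle_map t \<equiv> cis (2 * pi * t)"

lemma torus_char_cis: "torus_char k t = cis (2 * pi * (of_int k * t))"
  by (simp add: exp_family_def cis_conv_exp mult_ac)

lemma exp_family_eq_torus_char: "exp_family \<phi> k x = torus_char k (\<phi> x)"
  by (simp add: exp_family_def)

lemma torus_char_mult: "torus_char j t * torus_char k t = torus_char (j + k) t"
  by (simp add: torus_char_cis cis_mult algebra_simps)

lemma cnj_torus_char: "cnj (torus_char k t) = torus_char (- k) t"
  by (simp add: torus_char_cis cis_cnj)

lemma torus_char_0 [simp]: "torus_char 0 t = 1"
  by (simp add: torus_char_cis)

lemma continuous_on_torus_char [continuous_intros]:
  "continuous_on S f \<Longrightarrow> continuous_on S (\<lambda>x. torus_char k (f x))"
  unfolding torus_char_cis by (intro continuous_intros)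

text \<open>
  The circle is the real line modulo 1; this is how statements about points of the circle become
  statements about integers.
\<close>

lemma circle_map_eq_iff: "circle_map s = circle_map t \<longleftrightarrow> s - t \<in> \<int>"
proof -
  have "circle_map s = circle_map t \<longleftrightarrow> circle_map (s - t) = 1"
    by (simp add: right_diff_distrib flip: cis_divide)
  also have "\<dots> \<longleftrightarrow> exp (2 * of_real pi * \<i> * of_real (s - t)) = 1"
    by (simp add: cis_conv_exp mult_ac)
  also have "\<dots> \<longleftrightarrow> (\<exists>n::int. s - t = of_int n)"
    unfolding exp_eq_1 by auto
  finally show ?thesis by (auto simp: Ints_def)
qed

lemma integral_torus_char:
  "(LINT t|lebesgue_on {0..1}. torus_char k t) = (if k = 0 then 1 else 0)"
proof (cases "k = 0")
  case True
  then show ?thesis by (simp add: measure_restrict_space)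
next
  case False
  define c where "c = 2 * of_real pi * \<i> * (of_int k :: complex)"
  have c: "c \<noteq> 0" using False by (simp add: c_def)
  have "((\<lambda>t. exp (c * of_real t)) has_integral exp (c * of_real 1) / c - exp (c * of_real 0) / c) {0..1}"
  proof (rule fundamental_theorem_of_calculus)
    fix x :: real
    show "((\<lambda>x. exp (c * of_real x) / c) has_vector_derivative exp (c * of_real x)) (at x within {0..1})"
      unfolding has_real_derivative_iff_has_vector_derivative
      by (rule has_vector_derivative_real_field) (use c in \<open>auto intro!: derivative_eq_intros\<close>)
  qed auto
  moreover have "exp (c * of_real 1) = 1"
    unfolding exp_eq_1 c_def by (auto intro!: exI[of _ k])
  ultimately have "((\<lambda>t. torus_char k t) has_integral 0) {0..1}"
    by (simp add: exp_family_def c_def)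
  moreover have "integrable (lebesgue_on {0..1}) (torus_char k)"
    using continuous_on_torus_char[OF continuous_on_id] by (rule continuous_imp_integrable_real)
  ultimately show ?thesis
    using False by (subst lebesgue_integral_eq_integral) (auto simp: integral_unique)
qed

text \<open>
  Generating trigonometric polynomials from monomials and binary sums, rather than as indexed sums,
  turns closure under products into a double induction without any bookkeeping of index sets.
\<close>

inductive trig_poly :: "(real \<Rightarrow> complex) \<Rightarrow> bool" where
  monomial: "trig_poly (\<lambda>t. a * torus_char k t)"
| add: "trig_poly f \<Longrightarrow> trig_poly g \<Longrightarrow> trig_poly (\<lambda>t. f t + g t)"

lemma trig_poly_const: "trig_poly (\<lambda>t. a)"
  using monomial[of a 0] by simp

lemma trig_poly_mult:
  assumes "trig_poly f" "trig_poly g"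
  shows "trig_poly (\<lambda>t. f t * g t)"
  using assms(1)
proof induction
  case (monomial a k)
  from assms(2) show ?case
  proof induction
    case (monomial b j)
    have "(\<lambda>t. a * torus_char k t * (b * torus_char j t)) = (\<lambda>t. (a * b) * torus_char (k + j) t)"
      by (simp add: mult_ac flip: torus_char_mult)
    then show ?case by (simp only: trig_poly.monomial)
  next
    case (add f g)
    then show ?case by (simp only: distrib_left trig_poly.add)
  qed
next
  case (add f g)
  then show ?case by (simp only: distrib_right trig_poly.add)
qed

lemma continuous_on_trig_poly:
  assumes "trig_poly p" "continuous_on S f"
  shows "continuous_on S (\<lambda>x. p (f x))"
  using assms by induction (auto intro!: continuous_intros)

lemma trig_poly_eq_sum:
  assumes "trig_poly p"
  shows "\<exists>S c. finite S \<and> p = (\<lambda>t. \<Sum>k\<in>S. c k * torus_char k t)"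
  using assms
proof induction
  case (monomial a k)
  show ?case by (intro exI[of _ "{k}"] exI[of _ "\<lambda>_. a"]) simp
next
  case (add f g)
  then obtain S c T d where S: "finite S" "f = (\<lambda>t. \<Sum>k\<in>S. c k * torus_char k t)"
    and T: "finite T" "g = (\<lambda>t. \<Sum>k\<in>T. d k * torus_char k t)" by blast
  let ?c = "\<lambda>k. (if k \<in> S then c k else 0) + (if k \<in> T then d k else 0)"
  have "f t + g t = (\<Sum>k\<in>S \<union> T. ?c k * torus_char k t)" for t
  proof -
    have "f t = (\<Sum>k\<in>S \<union> T. (if k \<in> S then c k else 0) * torus_char k t)"
      unfolding S(2) using S(1) T(1) by (intro sum.mono_neutral_cong_left) auto
    moreover have "g t = (\<Sum>k\<in>S \<union> T. (if k \<in> T then d k else 0) * torus_char k t)"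
      unfolding T(2) using S(1) T(1) by (intro sum.mono_neutral_cong_left) auto
    ultimately show ?thesis by (simp add: distrib_right sum.distrib)
  qed
  then show ?case using S(1) T(1) by (intro exI[of _ "S \<union> T"] exI[of _ ?c]) auto
qed

text \<open>
  On the unit circle both coordinates are trigonometric polynomials, by Euler's formulas.  This makes
  the Stone--Weierstrass theorem for polynomials in the plane a theorem about trigonometric
  polynomials.
\<close>

lemma trig_poly_real_polynomial_function:
  assumes "real_polynomial_function (p :: complex \<Rightarrow> real)"
  shows "trig_poly (\<lambda>t. of_real (p (circle_map t)))"
  using assms
proof induction
  case (linear p)
  have "of_real (p (circle_map t)) =
      (of_real (p 1) - \<i> * of_real (p \<i>)) / 2 * torus_char 1 t
    + (of_real (p 1) + \<i> * of_real (p \<i>)) / 2 * torus_char (-1) t" for t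
  proof -
    have "p (circle_map t) = p (cos (2 * pi * t) *\<^sub>R 1 + sin (2 * pi * t) *\<^sub>R \<i>)"
      by (rule arg_cong[where f = p]) (simp add: complex_eq_iff)
    also have "\<dots> = cos (2 * pi * t) * p 1 + sin (2 * pi * t) * p \<i>"
      by (simp only: linear_add[OF bounded_linear.linear[OF linear]]
          linear_scale[OF bounded_linear.linear[OF linear]] real_scaleR_def)
    finally show ?thesis
      by (simp add: torus_char_cis complex_eq_iff field_simps)
  qed
  then show ?case by (simp only: trig_poly.intros)
next
  case (const c)
  show ?case by (rule trig_poly_const)
next
  case (add f g)
  then show ?case by (simp only: of_real_add trig_poly.add)
next
  case (mult f g)
  then show ?case by (simp only: of_real_mult trig_poly_mult)
qed

lemma trig_poly_approx:
  assumes "continuous_on (sphere 0 1) H" "0 < \<epsilon>"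
  obtains p where "trig_poly p" "\<And>t. cmod (H (circle_map t) - p t) < \<epsilon>"
proof -
  obtain g where g: "polynomial_function g" "\<And>z. z \<in> sphere 0 1 \<Longrightarrow> cmod (H z - g z) < \<epsilon>"
    using Stone_Weierstrass_polynomial_function[OF compact_sphere assms] by blast
  have "real_polynomial_function (\<lambda>z. Re (g z))" "real_polynomial_function (\<lambda>z. Im (g z))"
    using g(1) bounded_linear_Re bounded_linear_Im by (auto simp: polynomial_function_def o_def)
  then have "trig_poly (\<lambda>t. of_real (Re (g (circle_map t))) + \<i> * of_real (Im (g (circle_map t))))"
    by (intro trig_poly.add trig_poly_mult trig_poly_const trig_poly_real_polynomial_function)
  then have "trig_poly (\<lambda>t. g (circle_map t))"
    by (simp only: complex_eq[symmetric])
  with g(2) that show thesis by simp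
qed

section \<open>Equidistribution of \<open>\<phi>\<close> modulo 1\<close>

text \<open>
  The vanishing Fourier coefficients are used here: on monomials the two integrals agree,
  both being 0 unless the frequency is 0.
\<close>

lemma integral_trig_poly_compose:
  fixes \<phi> :: "real \<Rightarrow> real"
  assumes "continuous_on {0..1} \<phi>"
    and "\<And>k. k \<noteq> 0 \<Longrightarrow> (LINT x|lebesgue_on {0..1}. torus_char k (\<phi> x)) = 0"
    and "trig_poly p"
  shows "(LINT x|lebesgue_on {0..1}. p (\<phi> x)) = (LINT t|lebesgue_on {0..1}. p t)"
  using assms(3)
proof induction
  case (monomial a k)
  show ?case
    using assms(2)[of k] by (cases "k = 0") (simp_all add: integral_torus_char)
next
  case (add f g)
  have "integrable (lebesgue_on {0..1}) (\<lambda>x. h (\<phi> x))" "integrable (lebesgue_on {0..1}) h"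
    if "trig_poly h" for h
    using continuous_on_trig_poly[OF that assms(1)] continuous_on_trig_poly[OF that continuous_on_id]
    by (auto intro: continuous_imp_integrable_real)
  with add show ?case by simp
qed

lemma norm_integral_unit_le:
  fixes f :: "real \<Rightarrow> complex"
  assumes "continuous_on {0..1} f" "\<And>x. x \<in> {0..1} \<Longrightarrow> cmod (f x) \<le> e"
  shows "cmod (LINT x|lebesgue_on {0..1}. f x) \<le> e"
proof -
  have "cmod (integral {0..1} f) \<le> e * (1 - 0)"
    using assms by (intro integral_bound) auto
  then show ?thesis
    using assms(1) by (subst lebesgue_integral_eq_integral) (auto intro: continuous_imp_integrable_real)
qed

lemma continuous_on_circle_compose:
  fixes H :: "complex \<Rightarrow> 'a::topological_space"
  assumes "continuous_on (sphere 0 1) H" "continuous_on S \<phi>"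
  shows "continuous_on S (\<lambda>x. H (circle_map (\<phi> x)))"
  by (rule continuous_on_compose2[OF assms(1)]) (auto intro!: continuous_intros assms(2))

lemma integral_circle_compose:
  fixes \<phi> :: "real \<Rightarrow> real" and H :: "complex \<Rightarrow> complex"
  assumes \<phi>: "continuous_on {0..1} \<phi>"
    and orth: "\<And>k. k \<noteq> 0 \<Longrightarrow> (LINT x|lebesgue_on {0..1}. torus_char k (\<phi> x)) = 0"
    and H: "continuous_on (sphere 0 1) H"
  shows "(LINT x|lebesgue_on {0..1}. H (circle_map (\<phi> x))) = (LINT t|lebesgue_on {0..1}. H (circle_map t))"
proof -
  have "cmod ((LINT x|lebesgue_on {0..1}. H (circle_map (\<phi> x))) - (LINT t|lebesgue_on {0..1}. H (circle_map t))) \<le> e"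
    if "e > 0" for e
  proof -
    obtain p where p: "trig_poly p" "\<And>t. cmod (H (circle_map t) - p t) < e / 2"
      using trig_poly_approx[OF H, of "e / 2"] \<open>e > 0\<close> by auto
    have *: "cmod ((LINT x|lebesgue_on {0..1}. H (circle_map (\<psi> x))) - (LINT x|lebesgue_on {0..1}. p (\<psi> x))) \<le> e / 2"
      if "continuous_on {0..1} \<psi>" for \<psi> :: "real \<Rightarrow> real"
    proof -
      note cont = continuous_on_circle_compose[OF H that] continuous_on_trig_poly[OF p(1) that]
      have "(LINT x|lebesgue_on {0..1}. H (circle_map (\<psi> x))) - (LINT x|lebesgue_on {0..1}. p (\<psi> x))
          = (LINT x|lebesgue_on {0..1}. H (circle_map (\<psi> x)) - p (\<psi> x))"
        using cont by (intro Bochner_Integration.integral_diff[symmetric] continuous_imp_integrable_real)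
      also have "cmod \<dots> \<le> e / 2"
        using cont p(2) by (intro norm_integral_unit_le continuous_intros) (auto intro: less_imp_le)
      finally show ?thesis .
    qed
    let ?I = "\<lambda>f. LINT x|lebesgue_on {0..1::real}. (f x :: complex)"
    have "?I (\<lambda>x. H (circle_map (\<phi> x))) - ?I (\<lambda>t. H (circle_map t))
        = (?I (\<lambda>x. H (circle_map (\<phi> x))) - ?I (\<lambda>x. p (\<phi> x))) - (?I (\<lambda>t. H (circle_map t)) - ?I p)"
      using integral_trig_poly_compose[OF \<phi> orth p(1)] by simp
    also have "cmod \<dots> \<le> e / 2 + e / 2"
      by (rule order_trans[OF norm_triangle_ineq4 add_mono[OF *[OF \<phi>] *[OF continuous_on_id]]])
    finally show ?thesis by simp
  qed
  then have "cmod ((LINT x|lebesgue_on {0..1}. H (circle_map (\<phi> x))) - (LINT t|lebesgue_on {0..1}. H (circle_map t))) \<le> 0"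
    by (rule field_le_epsilon) simp
  then show ?thesis by simp
qed

lemma circle_preimage_lmeasurable:
  fixes \<phi> :: "real \<Rightarrow> real"
  assumes "continuous_on {0..1} \<phi>" "open U"
  shows "{x \<in> {0..1}. circle_map (\<phi> x) \<in> U} \<in> lmeasurable"
proof (rule bounded_set_imp_lmeasurable)
  have "(\<lambda>x. circle_map (\<phi> x)) \<in> borel_measurable (lebesgue_on {0..1})"
    by (intro continuous_imp_measurable_on_sets_lebesgue continuous_intros assms) auto
  from measurable_sets[OF this, of U] assms(2)
  have "(\<lambda>x. circle_map (\<phi> x)) -` U \<inter> {0..1} \<in> sets lebesgue"
    by (simp add: sets_restrict_space_iff)
  also have "(\<lambda>x. circle_map (\<phi> x)) -` U \<inter> {0..1} = {x \<in> {0..1}. circle_map (\<phi> x) \<in> U}"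
    by auto
  finally show "{x \<in> {0..1}. circle_map (\<phi> x) \<in> U} \<in> sets lebesgue" .
qed (auto intro: bounded_subset[of "{0..1}"])

text \<open>
  A finite Borel measure on the circle is determined by its integrals of continuous functions: the
  indicator of an open set is the increasing limit of the continuous functions \<open>h n\<close>, which
  grow with the distance to the complement.  The complement has to be nonempty because the
  distance to the empty set is 0 by convention.
\<close>

lemma measure_circle_preimage:
  fixes \<phi> :: "real \<Rightarrow> real"
  assumes \<phi>: "continuous_on {0..1} \<phi>"
    and orth: "\<And>k. k \<noteq> 0 \<Longrightarrow> (LINT x|lebesgue_on {0..1}. torus_char k (\<phi> x)) = 0"
    and U: "open U" "U \<noteq> UNIV"
  shows "measure lebesgue {x \<in> {0..1}. circle_map (\<phi> x) \<in> U} = measure lebesgue {t \<in> {0..1}. circle_map t \<in> U}"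
proof -
  define h where "h n z = min 1 (real n * infdist z (- U))" for n z
  have h_lim: "(\<lambda>n. h n z) \<longlonglongrightarrow> indicator U z" for z
  proof (cases "z \<in> U")
    case True
    then have "infdist z (- U) > 0"
      using U by (subst infdist_pos_not_in_closed) (auto simp: closed_Compl)
    then have "filterlim (\<lambda>n. real n * infdist z (- U)) at_top sequentially"
      by (intro filterlim_at_top_mult_tendsto_pos[OF tendsto_const] filterlim_real_sequentially)
    then have "\<forall>\<^sub>F n in sequentially. 1 \<le> real n * infdist z (- U)"
      by (simp add: filterlim_at_top)
    then have "\<forall>\<^sub>F n in sequentially. h n z = 1"
      by eventually_elim (simp add: h_def)
    with True show ?thesis by (simp add: tendsto_eventually)
  next
    case False
    then show ?thesis by (simp add: h_def)
  qed
  have h_bound: "norm (h n z) \<le> 1" for n z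
    by (auto simp: h_def infdist_nonneg)
  have cont_h: "continuous_on S (h n)" for n S
    unfolding h_def by (intro continuous_intros)
  have *: "(\<lambda>n. LINT x|lebesgue_on {0..1}. h n (circle_map (\<psi> x)))
      \<longlonglongrightarrow> measure lebesgue {x \<in> {0..1}. circle_map (\<psi> x) \<in> U}"
    if \<psi>: "continuous_on {0..1} \<psi>" for \<psi> :: "real \<Rightarrow> real"
  proof -
    have cont: "continuous_on {0..1} (\<lambda>x. circle_map (\<psi> x))"
      by (intro continuous_intros \<psi>)
    then have [measurable]: "(\<lambda>x. circle_map (\<psi> x)) \<in> borel_measurable (lebesgue_on {0..1})"
      by (intro continuous_imp_measurable_on_sets_lebesgue) auto
    have [measurable]: "U \<in> sets borel" using U by simp
    have [measurable]: "h n \<in> borel_measurable borel" for n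
      by (intro borel_measurable_continuous_onI cont_h)
    have "(\<lambda>n. LINT x|lebesgue_on {0..1}. h n (circle_map (\<psi> x)))
        \<longlonglongrightarrow> (LINT x|lebesgue_on {0..1}. indicator U (circle_map (\<psi> x)))"
      using h_lim h_bound
      by (intro integral_dominated_convergence[where w = "\<lambda>_. 1"]) (auto intro!: continuous_imp_integrable_real)
    also have "(LINT x|lebesgue_on {0..1}. indicator U (circle_map (\<psi> x)))
        = (LINT x|lebesgue_on {0..1}. indicator {x \<in> {0..1}. circle_map (\<psi> x) \<in> U} x)"
      by (intro Bochner_Integration.integral_cong) (auto simp: indicator_def)
    also have "\<dots> = measure (lebesgue_on {0..1}) {x \<in> {0..1}. circle_map (\<psi> x) \<in> U}"
      by (simp add: Int_absorb2 subset_eq)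
    also have "\<dots> = measure lebesgue {x \<in> {0..1}. circle_map (\<psi> x) \<in> U}"
      by (intro measure_restrict_space) auto
    finally show ?thesis .
  qed
  have "(LINT x|lebesgue_on {0..1}. h n (circle_map (\<phi> x))) = (LINT t|lebesgue_on {0..1}. h n (circle_map t))" for n
  proof -
    have "continuous_on (sphere 0 1) (\<lambda>z. complex_of_real (h n z))"
      by (intro continuous_intros cont_h)
    from integral_circle_compose[OF \<phi> orth this] show ?thesis
      by simp
  qed
  then have "(\<lambda>n. LINT x|lebesgue_on {0..1}. h n (circle_map (\<phi> x)))
      \<longlonglongrightarrow> measure lebesgue {t \<in> {0..1}. circle_map t \<in> U}"
    using *[OF continuous_on_id] by simp
  then show ?thesis
    by (rule LIMSEQ_unique[OF *[OF \<phi>]])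
qed

text \<open>
  The open arc from \<open>u\<close> to \<open>v\<close> is the complement in the circle of the compact image of
  \<open>{v..u + 1}\<close>, so the measures of its preimages can be compared.  The set \<open>S\<close> may be
  any superset of finite measure of the preimage under \<open>\<phi>\<close>: intervals are convenient in
  the applications, since their measure is known.
\<close>

lemma arc_length_le:
  fixes \<phi> :: "real \<Rightarrow> real"
  assumes \<phi>: "continuous_on {0..1} \<phi>"
    and orth: "\<And>k. k \<noteq> 0 \<Longrightarrow> (LINT x|lebesgue_on {0..1}. torus_char k (\<phi> x)) = 0"
    and uv: "0 \<le> u" "u < v" "v \<le> 1"
    and S: "S \<in> lmeasurable"
      "\<And>x n. x \<in> {0..1} \<Longrightarrow> u < \<phi> x + of_int n \<Longrightarrow> \<phi> x + of_int n < v \<Longrightarrow> x \<in> S"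
  shows "v - u \<le> measure lebesgue S"
proof -
  define K where "K = circle_map ` {v..u + 1}"
  have "compact K"
    unfolding K_def by (intro compact_continuous_image continuous_intros) auto
  then have "open (- K)" by (simp add: compact_imp_closed open_Compl)
  have "circle_map u \<in> K"
  proof -
    have "circle_map u = circle_map (u + 1)" by (subst circle_map_eq_iff) simp
    then show ?thesis using uv by (auto simp: K_def)
  qed
  have "- K \<noteq> UNIV" using \<open>circle_map u \<in> K\<close> by (metis Compl_iff UNIV_I)
  have "v - u = measure lebesgue {u<..<v}"
    using uv by simp
  also have "\<dots> \<le> measure lebesgue {t \<in> {0..1}. circle_map t \<in> - K}"
  proof (rule measure_mono_fmeasurable[OF _ _ circle_preimage_lmeasurable[OF continuous_on_id \<open>open (- K)\<close>]])
    show "{u<..<v} \<subseteq> {t \<in> {0..1}. circle_map t \<in> - K}"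
    proof
      fix t assume t: "t \<in> {u<..<v}"
      have False if K: "circle_map t \<in> K"
      proof -
        obtain s where s: "circle_map t = circle_map s" "s \<in> {v..u + 1}"
          using K unfolding K_def by (rule imageE)
        then obtain n :: int where "t - s = of_int n"
          unfolding circle_map_eq_iff by (auto simp: Ints_def)
        with s(2) t have "0 < real_of_int (n + 1)" "real_of_int n < 0"
          using uv by simp_all
        then show False unfolding of_int_0_less_iff of_int_less_0_iff by simp
      qed
      with t uv show "t \<in> {t \<in> {0..1}. circle_map t \<in> - K}" by auto
    qed
  qed auto
  also have "\<dots> = measure lebesgue {x \<in> {0..1}. circle_map (\<phi> x) \<in> - K}"
    by (rule measure_circle_preimage[OF \<phi> orth \<open>open (- K)\<close> \<open>- K \<noteq> UNIV\<close>, symmetric])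
  also have "\<dots> \<le> measure lebesgue S"
  proof (rule measure_mono_fmeasurable[OF _ _ S(1)])
    show "{x \<in> {0..1}. circle_map (\<phi> x) \<in> - K} \<in> sets lebesgue"
      by (rule fmeasurableD[OF circle_preimage_lmeasurable[OF \<phi> \<open>open (- K)\<close>]])
    show "{x \<in> {0..1}. circle_map (\<phi> x) \<in> - K} \<subseteq> S"
    proof
      fix x assume x: "x \<in> {x \<in> {0..1}. circle_map (\<phi> x) \<in> - K}"
      \<comment> \<open>The representative of \<open>\<phi> x\<close> modulo 1 in the period that starts at \<open>u\<close>.\<close>
      define n where "n = - \<lfloor>\<phi> x - u\<rfloor>"
      define w where "w = \<phi> x + of_int n"
      have "u \<le> w" "w < u + 1" unfolding w_def n_def by linarith+
      have w: "circle_map w = circle_map (\<phi> x)"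
        by (simp add: circle_map_eq_iff w_def)
      have "circle_map w \<notin> K" using x unfolding w by simp
      then have "w \<noteq> u" using \<open>circle_map u \<in> K\<close> by metis
      moreover have "\<not> v \<le> w"
      proof
        assume "v \<le> w"
        then have "circle_map w \<in> K"
          unfolding K_def using \<open>w < u + 1\<close> by (intro imageI) simp
        with \<open>circle_map w \<notin> K\<close> show False ..
      qed
      ultimately have "u < w" "w < v" using \<open>u \<le> w\<close> by linarith+
      then show "x \<in> S"
        using S(2)[of x n] x unfolding w_def by simp
    qed
  qed
  finally show ?thesis .
qed

section \<open>Total families separate almost all points\<close>

lemma cmod_add_squared_le: "(cmod (a + b))\<^sup>2 \<le> 2 * (cmod a)\<^sup>2 + 2 * (cmod b)\<^sup>2"
proof -
  have "(cmod (a + b))\<^sup>2 \<le> (cmod a + cmod b)\<^sup>2"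
    by (intro power_mono norm_triangle_ineq norm_ge_zero)
  also have "\<dots> \<le> 2 * (cmod a)\<^sup>2 + 2 * (cmod b)\<^sup>2"
    using zero_le_power2[of "cmod a - cmod b"] by (simp add: power2_sum power2_diff)
  finally show ?thesis .
qed

lemma L2_space_add:
  assumes f: "f \<in> L2_space M" and g: "g \<in> L2_space M"
  shows "(\<lambda>x. f x + g x) \<in> L2_space M"
proof -
  have [measurable]: "f \<in> borel_measurable M" "g \<in> borel_measurable M"
    using f g by (auto simp: L2_space_def)
  have "integrable M (\<lambda>x. 2 * (cmod (f x))\<^sup>2 + 2 * (cmod (g x))\<^sup>2)"
    using f g by (auto simp: L2_space_def)
  then have "integrable M (\<lambda>x. (cmod (f x + g x))\<^sup>2)"
    by (rule Bochner_Integration.integrable_bound) (auto simp: cmod_add_squared_le)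
  then show ?thesis by (simp add: L2_space_def)
qed

lemma L2_space_cmult:
  assumes "f \<in> L2_space M"
  shows "(\<lambda>x. c * f x) \<in> L2_space M"
  using assms by (auto simp: L2_space_def norm_mult power_mult_distrib)

lemma L2_space_diff:
  assumes "f \<in> L2_space M" "g \<in> L2_space M"
  shows "(\<lambda>x. f x - g x) \<in> L2_space M"
  using L2_space_add[OF assms(1) L2_space_cmult[OF assms(2), of "-1"]] by simp

lemma L2_space_sum:
  assumes "\<And>i. i \<in> S \<Longrightarrow> f i \<in> L2_space M"
  shows "(\<lambda>x. \<Sum>i\<in>S. f i x) \<in> L2_space M"
  using assms
  by (induction S rule: infinite_finite_induct) (auto intro: L2_space_add, auto simp: L2_space_def)

text \<open>
  If linear combinations of the \<open>e i\<close> converge to the coordinate function in \<open>L\<^sup>2\<close>, a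
  subsequence converges almost everywhere.  Off the exceptional set the values of the \<open>e i\<close> at a
  point determine all terms of that subsequence, hence the limit, which is the point itself.
\<close>

lemma L2_total_separates:
  fixes e :: "'i \<Rightarrow> real \<Rightarrow> complex"
  assumes "L2_total (lebesgue_on {0..1}) e" "\<And>i. e i \<in> L2_space (lebesgue_on {0..1})"
  obtains B where "B \<subseteq> {0..1}" "B \<in> null_sets lebesgue"
    "\<And>x y. x \<in> {0..1} - B \<Longrightarrow> y \<in> {0..1} - B \<Longrightarrow> (\<And>i. e i x = e i y) \<Longrightarrow> x = y"
proof -
  let ?M = "lebesgue_on {0..1::real}"
  have id_meas: "complex_of_real \<in> borel_measurable ?M"
    by (intro continuous_imp_measurable_on_sets_lebesgue continuous_intros) auto
  have id: "complex_of_real \<in> L2_space ?M"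
    using id_meas by (auto simp: L2_space_def intro!: continuous_imp_integrable_real continuous_intros)
  have "\<exists>S c. finite S \<and> L2_norm ?M (\<lambda>x. of_real x - (\<Sum>i\<in>S. c i * e i x)) < inverse (real (Suc n))" for n
    using assms(1) id unfolding L2_total_def by (meson inverse_positive_iff_positive of_nat_0_less_iff zero_less_Suc)
  then obtain S c where S: "\<And>n. finite (S n)"
    and approx: "\<And>n. L2_norm ?M (\<lambda>x. of_real x - (\<Sum>i\<in>S n. c n i * e i x)) < inverse (real (Suc n))"
    by metis
  define P where "P n x = (\<Sum>i\<in>S n. c n i * e i x)" for n x
  define u where "u n x = (cmod (of_real x - P n x))\<^sup>2" for n x
  have P_L2: "P n \<in> L2_space ?M" for n
    unfolding P_def using assms(2) by (intro L2_space_sum L2_space_cmult)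
  have u_int: "integrable ?M (u n)" for n
    using L2_space_diff[OF id P_L2[of n]] by (simp add: L2_space_def u_def[abs_def])
  have u_bound: "(\<integral>x. u n x \<partial>?M) \<le> inverse (real (Suc n))" for n
  proof -
    have "sqrt (\<integral>x. u n x \<partial>?M) < inverse (real (Suc n))"
      using approx[of n] by (simp add: L2_norm_def u_def P_def)
    then have "(\<integral>x. u n x \<partial>?M) < (inverse (real (Suc n)))\<^sup>2"
      using real_sqrt_less_iff[of "\<integral>x. u n x \<partial>?M" "(inverse (real (Suc n)))\<^sup>2"] by simp
    also have "\<dots> \<le> inverse (real (Suc n))"
      unfolding power2_eq_square by (rule mult_left_le) (simp_all add: field_simps)
    finally show ?thesis by simp
  qed
  have "(\<lambda>n. \<integral>x. norm (u n x) \<partial>?M) \<longlonglongrightarrow> 0"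
  proof (rule tendsto_sandwich[OF _ _ tendsto_const LIMSEQ_inverse_real_of_nat])
    show "\<forall>\<^sub>F n in sequentially. (\<integral>x. norm (u n x) \<partial>?M) \<le> inverse (real (Suc n))"
      using u_bound by (simp add: u_def)
  qed (simp add: integral_nonneg)
  then obtain r where "AE x in ?M. (\<lambda>n. u (r n) x) \<longlonglongrightarrow> 0"
    using tendsto_L1_AE_subseq[of ?M u] u_int by blast
  then obtain B where B: "B \<in> null_sets ?M" "{x \<in> space ?M. \<not> (\<lambda>n. u (r n) x) \<longlonglongrightarrow> 0} \<subseteq> B"
    by (auto simp: eventually_ae_filter)
  have lim: "(\<lambda>n. P (r n) x) \<longlonglongrightarrow> of_real x" if "x \<in> {0..1} - B" for x
  proof -
    have "(\<lambda>n. u (r n) x) \<longlonglongrightarrow> 0" using that B(2) by auto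
    then have "(\<lambda>n. sqrt (u (r n) x)) \<longlonglongrightarrow> sqrt 0" by (intro tendsto_intros)
    then have "(\<lambda>n. of_real x - P (r n) x) \<longlonglongrightarrow> 0"
      by (simp add: u_def tendsto_norm_zero_iff)
    from tendsto_diff[OF tendsto_const[of "of_real x"] this] show ?thesis by simp
  qed
  show thesis
  proof (rule that)
    show "B \<subseteq> {0..1}" "B \<in> null_sets lebesgue"
      using B(1) by (auto simp: null_sets_restrict_space)
    fix x y assume xy: "x \<in> {0..1} - B" "y \<in> {0..1} - B" "\<And>i. e i x = e i y"
    then have "P (r n) x = P (r n) y" for n by (simp add: P_def)
    then have "(\<lambda>n. P (r n) x) \<longlonglongrightarrow> of_real y"
      using lim[OF xy(2)] by simp
    then have "complex_of_real x = of_real y"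
      by (rule LIMSEQ_unique[OF lim[OF xy(1)]])
    then show "x = y" by simp
  qed
qed

section \<open>Rigidity of \<open>\<phi>\<close>\<close>

lemma interval_not_subset_null:
  fixes a b :: real
  assumes "a < b" "N \<in> null_sets lebesgue"
  obtains w where "a < w" "w < b" "w \<notin> N"
proof -
  have "\<not> {a<..<b} \<subseteq> N"
  proof
    assume "{a<..<b} \<subseteq> N"
    then have "{a<..<b} \<in> null_sets lebesgue"
      using assms(2) null_sets_subset by (metis lmeasurable_interval(2) box_real(1) fmeasurableD)
    then show False
      using assms(1) by (auto simp: null_sets_def)
  qed
  then obtain w where "w \<in> {a<..<b}" "w \<notin> N" by blast
  then show thesis using that[of w] by auto
qed

text \<open>
  Suppose \<open>\<phi> x = \<phi> z\<close>.  The function is not constant between \<open>x\<close> and \<open>z\<close>,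
  since an interval contains two points off the null set.  If it takes another value at
  \<open>y\<close>, all values in between are taken on both sides of \<open>y\<close>, and almost all of them
  are taken off \<open>B\<close> only, because the image of \<open>B\<close> is null.
\<close>

lemma inj_on_of_inj_off_null:
  fixes \<phi> :: "real \<Rightarrow> real"
  assumes cont: "continuous_on {a..b} \<phi>"
    and B: "B \<in> null_sets lebesgue" "\<phi> ` B \<in> null_sets lebesgue"
    and inj: "inj_on \<phi> ({a..b} - B)"
  shows "inj_on \<phi> {a..b}"
proof (rule linorder_inj_onI)
  fix x z assume xz: "x < z" "x \<in> {a..b}" "z \<in> {a..b}"
  show "\<phi> x \<noteq> \<phi> z"
  proof
    assume eq: "\<phi> x = \<phi> z"
    obtain y where y: "y \<in> {x..z}" "\<phi> y \<noteq> \<phi> x"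
    proof (rule ccontr)
      assume "\<not> thesis"
      with that have const: "\<phi> y = \<phi> x" if "y \<in> {x..z}" for y using that by blast
      obtain p where p: "x < p" "p < z" "p \<notin> B"
        using interval_not_subset_null[OF xz(1) B(1)] .
      obtain q where q: "p < q" "q < z" "q \<notin> B"
        using interval_not_subset_null[OF p(2) B(1)] .
      have "\<phi> p = \<phi> q" using const[of p] const[of q] p q by simp
      with inj_onD[OF inj] p q xz have "p = q" by force
      with q show False by simp
    qed
    obtain w where w: "min (\<phi> x) (\<phi> y) < w" "w < max (\<phi> x) (\<phi> y)" "w \<notin> \<phi> ` B"
      by (rule interval_not_subset_null[OF _ B(2), of "min (\<phi> x) (\<phi> y)" "max (\<phi> x) (\<phi> y)"])
        (use y in auto)
    have conts: "continuous_on (closed_segment x y) \<phi>" "continuous_on (closed_segment y z) \<phi>"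
      using y xz by (auto intro!: continuous_on_subset[OF cont] simp: closed_segment_eq_real_ivl)
    have "w \<in> closed_segment (\<phi> x) (\<phi> y)" "w \<in> closed_segment (\<phi> y) (\<phi> z)"
      using w eq by (auto simp: closed_segment_eq_real_ivl)
    then obtain p q where p: "p \<in> closed_segment x y" "\<phi> p = w"
      and q: "q \<in> closed_segment y z" "\<phi> q = w"
      using IVT'_closed_segment_real[OF _ conts(1)] IVT'_closed_segment_real[OF _ conts(2)] by blast
    have "p \<notin> B" "q \<notin> B"
      using w(3) imageI[of p B \<phi>] imageI[of q B \<phi>] unfolding p(2) q(2) by auto
    then have "p \<in> {a..b} - B" "q \<in> {a..b} - B"
      using p q xz y by (auto simp: closed_segment_eq_real_ivl)
    then have "p = q"
      using inj_onD[OF inj, of p q] unfolding p(2) q(2) by simp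
    with p q y have "p = y" by (auto simp: closed_segment_eq_real_ivl)
    with p w show False by auto
  qed
qed auto


text \<open>
  Injectivity makes \<open>\<phi>\<close> increasing, injectivity modulo 1 bounds \<open>\<phi> 1\<close> from above,
  and equidistribution bounds it from below.  Once \<open>\<phi> 1 = 1\<close> the two arcs into which
  0 and \<open>\<phi> s\<close> divide the circle have the preimages \<open>(0, s)\<close> and \<open>(s, 1)\<close>, and their
  lengths force \<open>\<phi> s = s\<close>.
\<close>

lemma basis_imp_identity:
  fixes \<phi> :: "real \<Rightarrow> real"
  assumes cont: "continuous_on {0..1} \<phi>"
    and lusin: "\<And>N. N \<subseteq> {0..1} \<Longrightarrow> N \<in> null_sets lebesgue \<Longrightarrow> \<phi> ` N \<in> null_sets lebesgue"
    and zero: "\<phi> 0 = 0" and "0 \<le> \<phi> 1"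
    and basis: "L2_orthonormal_basis (lebesgue_on {0..1}) (exp_family \<phi>)"
    and s: "s \<in> {0..1}"
  shows "\<phi> s = s"
proof -
  have orth: "(LINT x|lebesgue_on {0..1}. torus_char k (\<phi> x)) = 0" if "k \<noteq> 0" for k
  proof -
    have "L2_inner (lebesgue_on {0..1}) (exp_family \<phi> k) (exp_family \<phi> 0) = 0"
      using basis that by (simp add: L2_orthonormal_basis_def L2_orthonormal_def)
    then show ?thesis
      by (simp add: L2_inner_def exp_family_eq_torus_char[of \<phi>])
  qed
  note arc = arc_length_le[OF cont orth]
  obtain B where B: "B \<subseteq> {0..1}" "B \<in> null_sets lebesgue"
    and sep: "\<And>x y. x \<in> {0..1} - B \<Longrightarrow> y \<in> {0..1} - B
        \<Longrightarrow> (\<And>k. exp_family \<phi> k x = exp_family \<phi> k y) \<Longrightarrow> x = y"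
    using basis unfolding L2_orthonormal_basis_def L2_orthonormal_def
    by (metis L2_total_separates)
  have sep: "x = y" if "x \<in> {0..1} - B" "y \<in> {0..1} - B" "\<phi> x - \<phi> y \<in> \<int>" for x y
  proof (rule sep[OF that(1,2)])
    fix k
    have "of_int k * \<phi> x - of_int k * \<phi> y \<in> \<int>"
      using that(3) by (simp flip: right_diff_distrib)
    then show "exp_family \<phi> k x = exp_family \<phi> k y"
      by (simp add: exp_family_eq_torus_char[of \<phi>] torus_char_cis circle_map_eq_iff)
  qed
  define N where "N = \<phi> ` B"
  have N: "N \<in> null_sets lebesgue" unfolding N_def using B by (rule lusin)
  have inj: "inj_on \<phi> {0..1}"
    using cont B(2) N[unfolded N_def]
  proof (rule inj_on_of_inj_off_null)
    show "inj_on \<phi> ({0..1} - B)" by (intro inj_onI sep) auto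
  qed
  have pos: "0 < \<phi> 1"
    using inj_onD[OF inj, of 0 1] zero \<open>0 \<le> \<phi> 1\<close> by force
  have pos_mid: "0 < \<phi> y \<and> \<phi> y < \<phi> 1" if "0 < y" "y < 1" for y
    using continuous_inj_imp_mono[OF that cont inj] zero pos by auto
  have mono: "\<phi> x < \<phi> y" if "0 \<le> x" "x < y" "y \<le> 1" for x y
  proof (cases "x = 0 \<or> y = 1")
    case True
    then show ?thesis using pos pos_mid[of x] pos_mid[of y] that zero by (cases "x = 0"; cases "y = 1") auto
  next
    case False
    then have "0 < x" using that by auto
    moreover have "continuous_on {0..y} \<phi>" "inj_on \<phi> {0..y}"
      using that by (auto intro: continuous_on_subset[OF cont] inj_on_subset[OF inj])
    ultimately have "\<phi> 0 < \<phi> x \<and> \<phi> x < \<phi> y \<or> \<phi> y < \<phi> x \<and> \<phi> x < \<phi> 0"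
      by (intro continuous_inj_imp_mono that(2)) auto
    then show ?thesis using pos_mid[of x] \<open>0 < x\<close> that zero by auto
  qed
  have bounds: "0 \<le> \<phi> x" "\<phi> x \<le> \<phi> 1" if "x \<in> {0..1}" for x
    by (cases "x = 0"; cases "x = 1"; use mono[of 0 x] mono[of x 1] that zero pos in auto)+
  have surj: "\<exists>x\<in>{0..1}. \<phi> x = w" if "0 \<le> w" "w \<le> \<phi> 1" for w
    using IVT'[of \<phi> 0 w 1] that zero cont by auto
  have "\<phi> 1 \<le> 1"
  proof (rule ccontr)
    assume "\<not> \<phi> 1 \<le> 1"
    \<comment> \<open>Almost every \<open>w\<close> in \<open>(0, \<phi> 1 - 1)\<close> avoids \<open>N\<close> together with \<open>w + 1\<close>.\<close>
    have "(+) (-1) ` N \<in> null_sets lebesgue"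
      using N unfolding negligible_iff_null_sets[symmetric] by (rule negligible_translation)
    then have "N \<union> (+) (-1) ` N \<in> null_sets lebesgue"
      using N by blast
    then obtain w where w: "0 < w" "w < \<phi> 1 - 1" "w \<notin> N \<union> (+) (-1) ` N"
      using interval_not_subset_null[of 0 "\<phi> 1 - 1"] \<open>\<not> \<phi> 1 \<le> 1\<close> by (metis diff_gt_0_iff_gt not_le)
    have "w + 1 \<notin> N" using w(3) by force
    obtain p q where pq: "p \<in> {0..1}" "\<phi> p = w" "q \<in> {0..1}" "\<phi> q = w + 1"
      using surj[of w] surj[of "w + 1"] w by auto
    have "p \<notin> B" "q \<notin> B"
      using w(3) \<open>w + 1 \<notin> N\<close> imageI[of p B \<phi>] imageI[of q B \<phi>]
      unfolding N_def pq by auto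
    then have "p \<in> {0..1} - B" "q \<in> {0..1} - B"
      using pq by auto
    then have "p = q" by (rule sep) (simp add: pq)
    with pq show False by simp
  qed
  have no_wrap: "n = 0" if "x \<in> {0..1}" "0 < \<phi> x + of_int n" "\<phi> x + of_int n < 1" for x n
    using bounds[OF that(1)] that(2,3) \<open>\<phi> 1 \<le> 1\<close> by linarith
  have one: "\<phi> 1 = 1"
  proof (rule ccontr)
    assume "\<phi> 1 \<noteq> 1"
    then have "\<phi> 1 < 1" using \<open>\<phi> 1 \<le> 1\<close> by simp
    have "1 - \<phi> 1 \<le> measure lebesgue ({} :: real set)"
    proof (intro arc)
      fix x n assume x: "x \<in> {0..1}" "\<phi> 1 < \<phi> x + of_int n" "\<phi> x + of_int n < 1"
      then have "n = 0" using pos by (intro no_wrap[of x]) auto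
      with x bounds[of x] show "x \<in> {}" by auto
    qed (use pos \<open>\<phi> 1 < 1\<close> in auto)
    with \<open>\<phi> 1 < 1\<close> show False by simp
  qed
  show ?thesis
  proof (cases "s = 0 \<or> s = 1")
    case True
    then show ?thesis using zero one by auto
  next
    case False
    with s have s: "0 < s" "s < 1" by auto
    have \<phi>s: "0 < \<phi> s" "\<phi> s < 1" using pos_mid[OF s] one by auto
    have "\<phi> s - 0 \<le> measure lebesgue {0..s}"
    proof (intro arc)
      fix x n assume x: "x \<in> {0..1}" "0 < \<phi> x + of_int n" "\<phi> x + of_int n < \<phi> s"
      then have "n = 0" using \<phi>s by (intro no_wrap[of x]) auto
      with x mono[of s x] s show "x \<in> {0..s}" by force
    qed (use \<phi>s in auto)
    moreover have "1 - \<phi> s \<le> measure lebesgue {s..1}"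
    proof (intro arc)
      fix x n assume x: "x \<in> {0..1}" "\<phi> s < \<phi> x + of_int n" "\<phi> x + of_int n < 1"
      then have "n = 0" using \<phi>s by (intro no_wrap[of x]) auto
      with x mono[of x s] s show "x \<in> {s..1}" by force
    qed (use \<phi>s in auto)
    ultimately show ?thesis using s by simp
  qed
qed


section \<open>Invariance of orthonormal bases\<close>

lemma L2_orthonormal_basis_reindex:
  assumes "bij \<pi>" "L2_orthonormal_basis M e"
  shows "L2_orthonormal_basis M (\<lambda>i. e (\<pi> i))"
proof -
  have "L2_orthonormal M (\<lambda>i. e (\<pi> i))"
    using assms by (auto simp: L2_orthonormal_basis_def L2_orthonormal_def bij_def inj_eq)
  moreover have "\<exists>S c. finite S \<and> L2_norm M (\<lambda>x. f x - (\<Sum>i\<in>S. c i * e (\<pi> i) x)) < \<epsilon>"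
    if f: "f \<in> L2_space M" "\<epsilon> > 0" for f \<epsilon>
  proof -
    obtain S c where S: "finite S" "L2_norm M (\<lambda>x. f x - (\<Sum>i\<in>S. c i * e i x)) < \<epsilon>"
      using assms(2) f unfolding L2_orthonormal_basis_def L2_total_def by blast
    have "inj_on \<pi> (\<pi> -` S)"
      using bij_is_inj[OF assms(1)] by (rule inj_on_subset) simp
    then have "bij_betw \<pi> (\<pi> -` S) S"
      using surj_image_vimage_eq[OF bij_is_surj[OF assms(1)], of S] by (rule bij_betw_imageI)
    then have sum_eq: "(\<Sum>i\<in>\<pi> -` S. c (\<pi> i) * e (\<pi> i) x) = (\<Sum>i\<in>S. c i * e i x)" for x
      by (rule sum.reindex_bij_betw)
    have "finite (\<pi> -` S)"
      using S(1) bij_is_inj[OF assms(1)] by (rule finite_vimageI)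
    moreover have "L2_norm M (\<lambda>x. f x - (\<Sum>i\<in>\<pi> -` S. c (\<pi> i) * e (\<pi> i) x)) < \<epsilon>"
      using S(2) by (simp only: sum_eq)
    ultimately show ?thesis
      by (intro exI[of _ "\<pi> -` S"] exI[of _ "\<lambda>i. c (\<pi> i)"] conjI)
  qed
  ultimately show ?thesis
    unfolding L2_orthonormal_basis_def L2_total_def by simp
qed

text \<open>
  Changing the sign of \<open>\<phi>\<close> amounts to changing the sign of the frequencies.
\<close>

lemma exp_family_basis_uminus:
  assumes "L2_orthonormal_basis M (exp_family \<phi>)"
  shows "L2_orthonormal_basis M (exp_family (\<lambda>x. - \<phi> x))"
proof -
  have "exp_family (\<lambda>x. - \<phi> x) = (\<lambda>k. exp_family \<phi> (- k))"
    by (simp add: exp_family_def fun_eq_iff)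
  then show ?thesis
    using L2_orthonormal_basis_reindex[OF _ assms, of uminus] by (simp add: bij_uminus)
qed

lemma L2_orthonormal_basis_cong:
  assumes eq: "\<And>i x. x \<in> space M \<Longrightarrow> e i x = e' i x" and "L2_orthonormal_basis M e"
  shows "L2_orthonormal_basis M e'"
proof -
  have L2: "e i \<in> L2_space M \<longleftrightarrow> e' i \<in> L2_space M" for i
  proof -
    have "e i \<in> borel_measurable M \<longleftrightarrow> e' i \<in> borel_measurable M"
      by (rule measurable_cong) (rule eq)
    moreover have "integrable M (\<lambda>x. (cmod (e i x))\<^sup>2) \<longleftrightarrow> integrable M (\<lambda>x. (cmod (e' i x))\<^sup>2)"
      by (rule Bochner_Integration.integrable_cong) (simp_all add: eq)
    ultimately show ?thesis by (simp add: L2_space_def)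
  qed
  have inner: "L2_inner M (e i) (e j) = L2_inner M (e' i) (e' j)" for i j
    unfolding L2_inner_def by (rule Bochner_Integration.integral_cong) (simp_all add: eq)
  have norm: "L2_norm M (\<lambda>x. f x - (\<Sum>i\<in>S. c i * e i x)) = L2_norm M (\<lambda>x. f x - (\<Sum>i\<in>S. c i * e' i x))" for f S c
    unfolding L2_norm_def
    by (rule arg_cong[where f = sqrt], rule Bochner_Integration.integral_cong) (simp_all add: eq)
  show ?thesis
    using assms(2)
    unfolding L2_orthonormal_basis_def L2_orthonormal_def L2_total_def L2 inner norm .
qed

section \<open>The characters are an orthonormal basis\<close>

text \<open>
  A function on the unit interval with equal values at the end points descends to the circle.
  Continuity holds because the interval is compact: the preimage of a closed set downstairs is the
  image of a compact set upstairs.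
\<close>

lemma circle_lift:
  fixes h :: "real \<Rightarrow> 'a::topological_space"
  assumes h: "continuous_on {0..1} h" "h 0 = h 1"
  obtains H where "continuous_on (sphere 0 1) H" "\<And>t. t \<in> {0..1} \<Longrightarrow> H (circle_map t) = h t"
proof -
  define \<theta> where "\<theta> z = Arg2pi z / (2 * pi)" for z
  have \<theta>_range: "\<theta> z \<in> {0..<1}" for z
    using Arg2pi_ge_0[of z] Arg2pi_lt_2pi[of z] by (simp add: \<theta>_def)
  have \<theta>: "circle_map (\<theta> z) = z" if "z \<in> sphere 0 1" for z
    using that Arg2pi_eq[of z] by (simp add: \<theta>_def cis_conv_exp)
  have h_\<theta>: "h (\<theta> (circle_map t)) = h t" if t: "t \<in> {0..1}" for t
  proof -
    have "circle_map (\<theta> (circle_map t)) = circle_map t" by (rule \<theta>) simp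
    then obtain n :: int where n: "\<theta> (circle_map t) - t = of_int n"
      unfolding circle_map_eq_iff by (auto simp: Ints_def)
    with t \<theta>_range[of "circle_map t"] have "real_of_int n < 1" "- 2 < real_of_int n" by auto
    then have "n = 0 \<or> n = -1" by linarith
    then show ?thesis
    proof
      assume "n = -1"
      with n t \<theta>_range[of "circle_map t"] have "\<theta> (circle_map t) = 0" "t = 1" by auto
      with h(2) show ?thesis by simp
    qed (use n in simp)
  qed
  show thesis
  proof (rule that)
    show "continuous_on (sphere 0 1) (\<lambda>z. h (\<theta> z))"
      unfolding continuous_on_closed_vimage[OF closed_sphere]
    proof (intro allI impI)
      fix C :: "'a set" assume "closed C"
      have "closed (h -` C \<inter> {0..1})"
        using h(1) \<open>closed C\<close> by (simp add: continuous_on_closed_vimage)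
      then have "compact ({0..1} \<inter> (h -` C \<inter> {0..1}))"
        by (intro compact_Int_closed) auto
      then have "compact (circle_map ` ({0..1} \<inter> (h -` C \<inter> {0..1})))"
        by (intro compact_continuous_image continuous_intros)
      moreover have "circle_map ` ({0..1} \<inter> (h -` C \<inter> {0..1})) = (\<lambda>z. h (\<theta> z)) -` C \<inter> sphere 0 1"
      proof (intro equalityI subsetI)
        fix z assume "z \<in> (\<lambda>z. h (\<theta> z)) -` C \<inter> sphere 0 1"
        then have "circle_map (\<theta> z) = z" "\<theta> z \<in> {0..1} \<inter> (h -` C \<inter> {0..1})"
          using \<theta> \<theta>_range[of z] by auto
        then show "z \<in> circle_map ` ({0..1} \<inter> (h -` C \<inter> {0..1}))"
          by (metis image_eqI)
      next
        fix z assume "z \<in> circle_map ` ({0..1} \<inter> (h -` C \<inter> {0..1}))"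
        then obtain t where "z = circle_map t" "t \<in> {0..1} \<inter> (h -` C \<inter> {0..1})"
          by (rule imageE)
        then show "z \<in> (\<lambda>z. h (\<theta> z)) -` C \<inter> sphere 0 1"
          using h_\<theta>[of t] by simp
      qed
      ultimately show "closed ((\<lambda>z. h (\<theta> z)) -` C \<inter> sphere 0 1)"
        by (simp add: compact_imp_closed)
    qed
  qed (rule h_\<theta>)
qed

text \<open>
  A triangle inequality up to a constant, which suffices for approximation and saves Minkowski's
  inequality.
\<close>

lemma integral_cmod_squared_add_le:
  assumes "f \<in> L2_space M" "g \<in> L2_space M"
  shows "(LINT x|M. (cmod (f x + g x))\<^sup>2) \<le> 2 * (LINT x|M. (cmod (f x))\<^sup>2) + 2 * (LINT x|M. (cmod (g x))\<^sup>2)"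
proof -
  have int: "integrable M (\<lambda>x. (cmod (f x))\<^sup>2)" "integrable M (\<lambda>x. (cmod (g x))\<^sup>2)"
    "integrable M (\<lambda>x. (cmod (f x + g x))\<^sup>2)"
    using assms L2_space_add[OF assms] by (simp_all add: L2_space_def)
  have "(LINT x|M. (cmod (f x + g x))\<^sup>2) \<le> (LINT x|M. 2 * (cmod (f x))\<^sup>2 + 2 * (cmod (g x))\<^sup>2)"
    using int by (intro integral_mono cmod_add_squared_le) auto
  also have "\<dots> = 2 * (LINT x|M. (cmod (f x))\<^sup>2) + 2 * (LINT x|M. (cmod (g x))\<^sup>2)"
    using int by simp
  finally show ?thesis .
qed

lemma L2_bounded_approx:
  assumes f: "f \<in> L2_space M" and "0 < \<delta>"
  obtains n :: nat where "(LINT x|M. (cmod (f x - (if cmod (f x) \<le> n then f x else 0)))\<^sup>2) < \<delta>"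
proof -
  have [measurable]: "f \<in> borel_measurable M" and int: "integrable M (\<lambda>x. (cmod (f x))\<^sup>2)"
    using f by (auto simp: L2_space_def)
  have "(\<lambda>n::nat. LINT x|M. (cmod (f x - (if cmod (f x) \<le> n then f x else 0)))\<^sup>2) \<longlonglongrightarrow> (LINT x|M. 0)"
  proof (rule integral_dominated_convergence[OF _ _ int])
    show "AE x in M. (\<lambda>n::nat. (cmod (f x - (if cmod (f x) \<le> n then f x else 0)))\<^sup>2) \<longlonglongrightarrow> 0"
    proof (rule AE_I2)
      fix x
      obtain m :: nat where "cmod (f x) \<le> m" using real_arch_simple by blast
      then have "\<forall>\<^sub>F n::nat in sequentially. (cmod (f x - (if cmod (f x) \<le> n then f x else 0)))\<^sup>2 = 0"
        by (intro eventually_sequentiallyI[of m]) auto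
      then show "(\<lambda>n::nat. (cmod (f x - (if cmod (f x) \<le> n then f x else 0)))\<^sup>2) \<longlonglongrightarrow> 0"
        by (rule tendsto_eventually)
    qed
  qed auto
  then have "(\<lambda>n::nat. LINT x|M. (cmod (f x - (if cmod (f x) \<le> n then f x else 0)))\<^sup>2) \<longlonglongrightarrow> 0"
    by simp
  from order_tendstoD(2)[OF this \<open>0 < \<delta>\<close>] show thesis
    using that by (auto simp: eventually_sequentially)
qed

lemma continuous_in_L2_space:
  fixes h :: "real \<Rightarrow> complex"
  assumes "continuous_on {0..1} h"
  shows "h \<in> L2_space (lebesgue_on {0..1})"
  unfolding L2_space_def using assms
  by (auto intro!: continuous_imp_measurable_on_sets_lebesgue continuous_imp_integrable_real continuous_intros)

text \<open>
  A measurable function is an almost everywhere limit of continuous functions \<open>g n\<close>.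
  Projecting their values to the ball that contains the values of \<open>f\<close> makes the convergence
  dominated, and multiplying by a cutoff that tends to 1 on the open interval makes them
  vanish at the end points.
\<close>

lemma continuous_approx_bounded:
  fixes f :: "real \<Rightarrow> complex"
  assumes f: "f \<in> borel_measurable (lebesgue_on {0..1})" "\<And>x. cmod (f x) \<le> B" and "0 < \<delta>"
  obtains h where "continuous_on {0..1} h" "h 0 = 0" "h 1 = 0"
    "(LINT x|lebesgue_on {0..1}. (cmod (f x - h x))\<^sup>2) < \<delta>"
proof -
  let ?M = "lebesgue_on {0..1::real}"
  have "0 \<le> B" using f(2)[of 0] norm_ge_zero order_trans by blast
  have "f measurable_on {0..1}"
    using f(1) by (subst measurable_on_iff_borel_measurable) auto
  then obtain N g where N: "negligible N" and g: "\<And>n. continuous_on UNIV (g n)"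
    and lim: "\<And>x. x \<notin> N \<Longrightarrow> (\<lambda>n. g n x) \<longlonglongrightarrow> (if x \<in> {0..1} then f x else 0)"
    unfolding measurable_on_def by blast
  define w where "w n x = min 1 (real n * min x (1 - x))" for n x
  define h where "h n x = w n x *\<^sub>R closest_point (cball 0 B) (g n x)" for n :: nat and x
  have cont_proj: "continuous_on UNIV (closest_point (cball (0::complex) B))"
    using \<open>0 \<le> B\<close> by (intro continuous_on_closest_point) auto
  have cont_h: "continuous_on {0..1} (h n)" for n
  proof -
    have "continuous_on {0..1} (\<lambda>x. closest_point (cball 0 B) (g n x))"
      by (rule continuous_on_compose2[OF cont_proj continuous_on_subset[OF g]]) auto
    then show ?thesis
      unfolding h_def w_def by (intro continuous_intros)
  qed
  have h_bound: "cmod (h n x) \<le> B" if "x \<in> {0..1}" for n x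
  proof -
    have "closest_point (cball 0 B) (g n x) \<in> cball 0 B"
      using \<open>0 \<le> B\<close> by (intro closest_point_in_set) auto
    moreover have "\<bar>w n x\<bar> \<le> 1"
      using that by (auto simp: w_def)
    ultimately show ?thesis
      using mult_mono[of "\<bar>w n x\<bar>" 1 "cmod (closest_point (cball 0 B) (g n x))" B] by (simp add: h_def)
  qed
  have h_lim: "(\<lambda>n. h n x) \<longlonglongrightarrow> f x" if x: "x \<in> {0..1}" "x \<notin> N \<union> {0, 1}" for x
  proof -
    have "(\<lambda>n. closest_point (cball 0 B) (g n x)) \<longlonglongrightarrow> closest_point (cball 0 B) (f x)"
      using lim[of x] x continuous_on_tendsto_compose[OF cont_proj, of "\<lambda>n. g n x" "f x" sequentially] by simp
    moreover have "closest_point (cball 0 B) (f x) = f x"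
      using f(2)[of x] by (intro closest_point_self) simp
    moreover have "(\<lambda>n. w n x) \<longlonglongrightarrow> 1"
    proof -
      have "0 < min x (1 - x)" using x by auto
      then have "filterlim (\<lambda>n. real n * min x (1 - x)) at_top sequentially"
        by (intro filterlim_at_top_mult_tendsto_pos[OF tendsto_const] filterlim_real_sequentially)
      then have "\<forall>\<^sub>F n in sequentially. 1 \<le> real n * min x (1 - x)"
        unfolding filterlim_at_top by blast
      then have "\<forall>\<^sub>F n in sequentially. w n x = 1"
        by eventually_elim (simp only: w_def min_absorb1)
      then show ?thesis by (rule tendsto_eventually)
    qed
    ultimately have "(\<lambda>n. h n x) \<longlonglongrightarrow> 1 *\<^sub>R f x"
      unfolding h_def by (intro tendsto_scaleR) simp_all
    then show ?thesis by simp
  qed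
  have [measurable]: "h n \<in> borel_measurable ?M" for n
    using cont_h by (intro continuous_imp_measurable_on_sets_lebesgue) auto
  have "(\<lambda>n. LINT x|?M. (cmod (f x - h n x))\<^sup>2) \<longlonglongrightarrow> (LINT x|?M. 0)"
  proof (rule integral_dominated_convergence[where w = "\<lambda>_. (2 * B)\<^sup>2"])
    have "N \<union> {0, 1} \<in> null_sets lebesgue"
      using N by (simp flip: negligible_iff_null_sets)
    then have "AE x in lebesgue. x \<notin> N \<union> {0, 1}"
      by (rule AE_not_in)
    then have "AE x in ?M. x \<notin> N \<union> {0, 1}"
      by (subst AE_restrict_space_iff) auto
    moreover have "AE x in ?M. x \<in> {0..1}"
      by (rule AE_I2) simp
    ultimately show "AE x in ?M. (\<lambda>n. (cmod (f x - h n x))\<^sup>2) \<longlonglongrightarrow> 0"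
    proof eventually_elim
      case (elim x)
      then have "(\<lambda>n. (cmod (f x - h n x))\<^sup>2) \<longlonglongrightarrow> (cmod (f x - f x))\<^sup>2"
        by (intro tendsto_intros h_lim)
      then show ?case by simp
    qed
    show "AE x in ?M. norm ((cmod (f x - h n x))\<^sup>2) \<le> (2 * B)\<^sup>2" for n
    proof (rule AE_I2)
      fix x assume "x \<in> space ?M"
      then have "cmod (f x - h n x) \<le> B + B"
        using f(2) h_bound by (intro order_trans[OF norm_triangle_ineq4] add_mono) auto
      then show "norm ((cmod (f x - h n x))\<^sup>2) \<le> (2 * B)\<^sup>2"
        using power_mono[of "cmod (f x - h n x)" "2 * B" 2] by simp
    qed
    show "(\<lambda>x. (cmod (f x - h n x))\<^sup>2) \<in> borel_measurable ?M" for n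
      using f(1) by measurable
  qed (auto intro!: continuous_imp_integrable_real)
  then have "(\<lambda>n. LINT x|?M. (cmod (f x - h n x))\<^sup>2) \<longlonglongrightarrow> 0" by simp
  from order_tendstoD(2)[OF this \<open>0 < \<delta>\<close>] obtain n where
    "(LINT x|?M. (cmod (f x - h n x))\<^sup>2) < \<delta>"
    by (auto simp: eventually_sequentially)
  then show thesis
    using cont_h by (intro that[of "h n"]) (simp_all add: h_def w_def)
qed

lemma trig_poly_approx_periodic:
  fixes h :: "real \<Rightarrow> complex"
  assumes h: "continuous_on {0..1} h" "h 0 = h 1" and "0 < \<delta>"
  obtains p where "trig_poly p" "(LINT x|lebesgue_on {0..1}. (cmod (h x - p x))\<^sup>2) \<le> \<delta>"
proof -
  obtain H where H: "continuous_on (sphere 0 1) H" "\<And>t. t \<in> {0..1} \<Longrightarrow> H (circle_map t) = h t"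
    using circle_lift[OF h] by blast
  obtain p where p: "trig_poly p" "\<And>t. cmod (H (circle_map t) - p t) < sqrt \<delta>"
    using trig_poly_approx[OF H(1), of "sqrt \<delta>"] \<open>0 < \<delta>\<close> by auto
  have "(LINT x|lebesgue_on {0..1}. (cmod (h x - p x))\<^sup>2) \<le> (LINT x|lebesgue_on {0..1::real}. \<delta>)"
  proof (rule integral_mono)
    show "integrable (lebesgue_on {0..1}) (\<lambda>x. (cmod (h x - p x))\<^sup>2)"
      by (intro continuous_imp_integrable_real continuous_intros h(1) continuous_on_trig_poly[OF p(1)])
    fix x assume "x \<in> space (lebesgue_on {0..1::real})"
    then have "cmod (h x - p x) \<le> sqrt \<delta>" using p(2)[of x] H(2)[of x] by simp
    then have "(cmod (h x - p x))\<^sup>2 \<le> (sqrt \<delta>)\<^sup>2" by (intro power_mono) auto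
    then show "(cmod (h x - p x))\<^sup>2 \<le> \<delta>" using \<open>0 < \<delta>\<close> by simp
  qed (auto intro!: continuous_imp_integrable_real)
  also have "\<dots> = \<delta>" by (simp add: measure_restrict_space)
  finally show thesis using that p(1) by blast
qed

lemma torus_char_total: "L2_total (lebesgue_on {0..1}) torus_char"
  unfolding L2_total_def
proof (intro ballI allI impI)
  let ?M = "lebesgue_on {0..1::real}"
  fix f :: "real \<Rightarrow> complex" and \<epsilon> :: real
  assume f: "f \<in> L2_space ?M" and "0 < \<epsilon>"
  \<comment> \<open>Two uses of the triangle inequality with constant 2 give the bound \<open>2 \<delta> + 2 (2 \<delta> + 2 \<delta>) = 10 \<delta>\<close>.\<close>
  define \<delta> where "\<delta> = \<epsilon>\<^sup>2 / 10"
  have "0 < \<delta>" using \<open>0 < \<epsilon>\<close> by (simp add: \<delta>_def)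
  obtain n :: nat where n: "(LINT x|?M. (cmod (f x - (if cmod (f x) \<le> n then f x else 0)))\<^sup>2) < \<delta>"
    using L2_bounded_approx[OF f \<open>0 < \<delta>\<close>] .
  define f1 where "f1 x = (if cmod (f x) \<le> n then f x else 0)" for x
  have fm[measurable]: "f \<in> borel_measurable ?M" using f by (simp add: L2_space_def)
  have f1m: "f1 \<in> borel_measurable ?M" unfolding f1_def by measurable
  have f1b: "cmod (f1 x) \<le> n" for x by (simp add: f1_def)
  have f1: "f1 \<in> L2_space ?M"
  proof -
    have "integrable ?M (\<lambda>x. (cmod (f1 x))\<^sup>2)"
    proof (rule Bochner_Integration.integrable_bound)
      show "integrable ?M (\<lambda>x. (cmod (f x))\<^sup>2)"
        using f by (simp add: L2_space_def)
      show "(\<lambda>x. (cmod (f1 x))\<^sup>2) \<in> borel_measurable ?M"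
        using f1m by measurable
      show "AE x in ?M. norm ((cmod (f1 x))\<^sup>2) \<le> norm ((cmod (f x))\<^sup>2)"
        by (simp add: f1_def)
    qed
    with f1m show ?thesis by (simp add: L2_space_def)
  qed
  obtain h where h: "continuous_on {0..1} h" "h 0 = 0" "h 1 = 0"
    "(LINT x|?M. (cmod (f1 x - h x))\<^sup>2) < \<delta>"
    using continuous_approx_bounded[OF f1m f1b \<open>0 < \<delta>\<close>] .
  obtain p where p: "trig_poly p" "(LINT x|?M. (cmod (h x - p x))\<^sup>2) \<le> \<delta>"
    using trig_poly_approx_periodic[OF h(1) _ \<open>0 < \<delta>\<close>] h(2,3) by auto
  have pL: "p \<in> L2_space ?M"
    by (intro continuous_in_L2_space continuous_on_trig_poly[OF p(1)] continuous_on_id)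
  note hL = continuous_in_L2_space[OF h(1)]
  have "(LINT x|?M. (cmod (f x - p x))\<^sup>2)
      \<le> 2 * (LINT x|?M. (cmod (f x - f1 x))\<^sup>2) + 2 * (LINT x|?M. (cmod (f1 x - p x))\<^sup>2)"
    using integral_cmod_squared_add_le[OF L2_space_diff[OF f f1] L2_space_diff[OF f1 pL]] by simp
  moreover have "(LINT x|?M. (cmod (f1 x - p x))\<^sup>2)
      \<le> 2 * (LINT x|?M. (cmod (f1 x - h x))\<^sup>2) + 2 * (LINT x|?M. (cmod (h x - p x))\<^sup>2)"
    using integral_cmod_squared_add_le[OF L2_space_diff[OF f1 hL] L2_space_diff[OF hL pL]] by simp
  moreover have "(LINT x|?M. (cmod (f x - f1 x))\<^sup>2) < \<delta>"
    using n by (simp add: f1_def)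
  ultimately have "(LINT x|?M. (cmod (f x - p x))\<^sup>2) < \<epsilon>\<^sup>2"
    using h(4) p(2) unfolding \<delta>_def by linarith
  then have "L2_norm ?M (\<lambda>x. f x - p x) < \<epsilon>"
    unfolding L2_norm_def using \<open>0 < \<epsilon>\<close> real_sqrt_less_mono by fastforce
  moreover obtain S c where "finite S" "p = (\<lambda>t. \<Sum>k\<in>S. c k * torus_char k t)"
    using trig_poly_eq_sum[OF p(1)] by blast
  ultimately show "\<exists>S c. finite S \<and> L2_norm ?M (\<lambda>x. f x - (\<Sum>k\<in>S. c k * torus_char k x)) < \<epsilon>"
    by blast
qed

lemma torus_char_orthonormal_basis: "L2_orthonormal_basis (lebesgue_on {0..1}) torus_char"
proof -
  have "torus_char k \<in> L2_space (lebesgue_on {0..1})" for k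
    by (intro continuous_in_L2_space continuous_on_torus_char continuous_on_id)
  moreover have "L2_inner (lebesgue_on {0..1}) (torus_char j) (torus_char k) = (if j = k then 1 else 0)" for j k
    by (simp add: L2_inner_def cnj_torus_char torus_char_mult integral_torus_char)
  ultimately show ?thesis
    using torus_char_total by (simp add: L2_orthonormal_basis_def L2_orthonormal_def)
qed

section \<open>The characterization\<close>

theorem theorem5p1:
  fixes \<phi> :: "real \<Rightarrow> real"
  assumes "continuous_on {0..1} \<phi>"
    and "\<And>N. N \<subseteq> {0..1} \<Longrightarrow> N \<in> null_sets lebesgue \<Longrightarrow> \<phi> ` N \<in> null_sets lebesgue"
    and "\<phi> 0 = 0"
  shows "L2_orthonormal_basis (lebesgue_on {0..1}) (exp_family \<phi>) \<longleftrightarrow>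
           (\<forall>x\<in>{0..1}. \<phi> x = x) \<or> (\<forall>x\<in>{0..1}. \<phi> x = - x)"
proof
  assume basis: "L2_orthonormal_basis (lebesgue_on {0..1}) (exp_family \<phi>)"
  show "(\<forall>x\<in>{0..1}. \<phi> x = x) \<or> (\<forall>x\<in>{0..1}. \<phi> x = - x)"
  proof (cases "0 \<le> \<phi> 1")
    case True
    then show ?thesis using basis_imp_identity[OF assms _ basis] by blast
  next
    case False
    have lusin: "(\<lambda>x. - \<phi> x) ` N \<in> null_sets lebesgue" if "N \<subseteq> {0..1}" "N \<in> null_sets lebesgue" for N
    proof -
      have "negligible (\<phi> ` N)"
        using assms(2)[OF that] by (simp add: negligible_iff_null_sets)
      then have "negligible (uminus ` \<phi> ` N)"
        by (rule negligible_differentiable_image_negligible[OF order_refl]) (intro derivative_intros)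
      then show ?thesis by (simp add: image_image negligible_iff_null_sets)
    qed
    have "- \<phi> s = s" if "s \<in> {0..1}" for s
      using basis_imp_identity[OF continuous_on_minus[OF assms(1)] lusin _ _
          exp_family_basis_uminus[OF basis] that] False assms(3) by simp
    then show ?thesis by (metis minus_equation_iff)
  qed
next
  assume "(\<forall>x\<in>{0..1}. \<phi> x = x) \<or> (\<forall>x\<in>{0..1}. \<phi> x = - x)"
  then show "L2_orthonormal_basis (lebesgue_on {0..1}) (exp_family \<phi>)"
  proof
    assume "\<forall>x\<in>{0..1}. \<phi> x = x"
    then show ?thesis
      by (intro L2_orthonormal_basis_cong[OF _ torus_char_orthonormal_basis]) (simp add: exp_family_def)
  next
    assume "\<forall>x\<in>{0..1}. \<phi> x = - x"
    then show ?thesis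
      by (intro L2_orthonormal_basis_cong[OF _ exp_family_basis_uminus[OF torus_char_orthonormal_basis]])
        (simp add: exp_family_def)
  qed
qed

end
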